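(* Let $u$ be a harmonic function in the open upper half-plane $\mathbb{H}$ which is of temperate growth at infinity. Assume that (1) $u(z)\to 0$ as $\mathbb{H}\ni z\to x$ for every $x\in\mathbb{R}$; and (2) there is an admissible function of angles $(E,\eta)$ such that $\displaystyle\lim_{t\to+\infty}u(te^{i\theta})/t^{\eta(\theta)}=0$ for every $\theta\in E$. Then $u(z)=0$ for all $z\in\mathbb{H}$.
   Context: $\mathbb{H}=\{z\in\mathbb{C}:\operatorname{Im} z>0\}$ is the open upper half-plane; $\mathbb{Z}^+=\{1,2,3,\dots\}$. Harmonic functions are complex-valued $C^2$ functions annihilated by the usual Laplacian. A function $u$ in $\mathbb{H}$ is of temperate growth at infinity if there are positive constants $C,R,N$ such that $|u(z)|\leq C\,(|z|^2/\operatorname{Im} z)^N$ for all $z\in\mathbb{H}$ with $|z|>R$. An admissible function of angles is a pair $(E,\eta)$ with $E\subset(0,\pi)$ a set and $\eta:E\to\mathbb{Z}^+$ a function such that for every $k\in\mathbb{Z}^+$ there exists $\theta\in E$ with $\sin(k\theta)\neq0$ and $k\geq\eta(\theta)$. *)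

theory Defs
  imports "HOL-Analysis.Analysis"
begin

definition upper_half_plane :: "complex set" where
  "upper_half_plane = {z. Im z > 0}"

text \<open>The plane is regarded as \<open>\<real>\<^sup>2\<close>: \<open>dir_deriv 1\<close> is the partial derivative with respect
  to \<open>x\<close> and \<open>dir_deriv \<i>\<close> the one with respect to \<open>y\<close>. The value is meaningful only where
  the derivative exists; \<open>Ck_on\<close> requires existence separately.\<close>

definition dir_deriv :: "complex \<Rightarrow> (complex \<Rightarrow> complex) \<Rightarrow> complex \<Rightarrow> complex" where
  "dir_deriv v u z = vector_derivative (\<lambda>t::real. u (z + t *\<^sub>R v)) (at 0)"

text \<open>\<open>Ck_on k S u\<close>: all iterated partial derivatives of \<open>u\<close> of order at most \<open>k\<close> exist and are
  continuous on \<open>S\<close>. Intended for open \<open>S\<close> only.\<close>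

primrec Ck_on :: "nat \<Rightarrow> complex set \<Rightarrow> (complex \<Rightarrow> complex) \<Rightarrow> bool" where
  "Ck_on 0 S u \<longleftrightarrow> continuous_on S u"
| "Ck_on (Suc k) S u \<longleftrightarrow> continuous_on S u \<and>
     (\<forall>v\<in>{1, \<i>}. (\<forall>z\<in>S. (\<lambda>t::real. u (z + t *\<^sub>R v)) differentiable (at 0)) \<and>
                 Ck_on k S (dir_deriv v u))"

definition laplacian :: "(complex \<Rightarrow> complex) \<Rightarrow> complex \<Rightarrow> complex" where
  "laplacian u z = dir_deriv 1 (dir_deriv 1 u) z + dir_deriv \<i> (dir_deriv \<i> u) z"

definition harmonic_on :: "complex set \<Rightarrow> (complex \<Rightarrow> complex) \<Rightarrow> bool" where
  "harmonic_on S u \<longleftrightarrow> open S \<and> Ck_on 2 S u \<and> (\<forall>z\<in>S. laplacian u z = 0)"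

definition temperate_growth_at_infinity :: "(complex \<Rightarrow> complex) \<Rightarrow> bool" where
  "temperate_growth_at_infinity u \<longleftrightarrow>
     (\<exists>C>0. \<exists>R>0. \<exists>N>0. \<forall>z\<in>upper_half_plane.
        cmod z > R \<longrightarrow> cmod (u z) \<le> C * ((cmod z)\<^sup>2 / Im z) powr N)"

text \<open>Only the values of \<open>\<eta>\<close> on \<open>E\<close> matter.\<close>

definition admissible_angles :: "real set \<Rightarrow> (real \<Rightarrow> nat) \<Rightarrow> bool" where
  "admissible_angles E \<eta> \<longleftrightarrow>
     E \<subseteq> {0<..<pi} \<and> (\<forall>\<theta>\<in>E. \<eta> \<theta> \<ge> 1) \<and>
     (\<forall>k\<ge>1. \<exists>\<theta>\<in>E. sin (real k * \<theta>) \<noteq> 0 \<and> k \<ge> \<eta> \<theta>)"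

end

theory Submission
  imports Defs "HOL-Complex_Analysis.Complex_Analysis"
begin

text \<open>Extend \<open>u\<close> by 0 and consider the sine coefficients on half circles,
  \<open>B k r = integral {0..pi} (\<lambda>t. u (r e^(it)) sin (k t))\<close>. Because \<open>u\<close> is harmonic and vanishes on the
  real axis, \<open>B k r = \<alpha> k * r ^ k\<close>; this replaces the reflection principle. The growth bound may be
  singular at the endpoints of the half circle, but testing against \<open>sin (k t)\<close> times a high power of
  \<open>sin t\<close>, which is again a combination of sines, shows \<open>\<alpha> k = 0\<close> for large \<open>k\<close>. By completeness of
  the sines, \<open>u (r e^(it))\<close> is a finite sum of terms \<open>c k * r ^ k * sin (k t)\<close>. On a ray this is a
  polynomial in \<open>r\<close>, and an angle that admissibility provides for \<open>k\<close> forces \<open>c k = 0\<close>.\<close>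

section \<open>Partial derivatives and the harmonic conjugate\<close>

text \<open>Translating by \<open>Re z\<close> turns the increments of \<open>dir_deriv\<close> into
  a function of one real coordinate, the form in which the fundamental theorem and the Leibniz rule
  apply later.\<close>

lemma has_vector_derivative_Re_line:
  fixes w :: "complex \<Rightarrow> complex"
  shows "((\<lambda>t. w (z + t *\<^sub>R 1)) has_vector_derivative a) (at 0) \<longleftrightarrow>
    ((\<lambda>x. w (Complex x (Im z))) has_vector_derivative a) (at (Re z))"
    (is "?L \<longleftrightarrow> ?R")
proof -
  have e1: "Complex x (Im z) = z + (x - Re z) *\<^sub>R 1"
    and e2: "z + t *\<^sub>R 1 = Complex (Re z + t) (Im z)" for x t
    by (simp_all add: complex_eq_iff)
  show ?thesis
  proof
    assume ?L
    then have "((\<lambda>t. w (z + t *\<^sub>R 1)) \<circ> (\<lambda>x. x - Re z) has_vector_derivative 1 *\<^sub>R a) (at (Re z))"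
      by (intro vector_diff_chain_at) (auto intro!: derivative_eq_intros)
    then show ?R by (simp only: o_def e1 scaleR_one)
  next
    assume ?R
    then have "((\<lambda>x. w (Complex x (Im z))) \<circ> (\<lambda>t. Re z + t) has_vector_derivative 1 *\<^sub>R a) (at 0)"
      by (intro vector_diff_chain_at) (auto intro!: derivative_eq_intros)
    then show ?L by (simp only: o_def e2 scaleR_one)
  qed
qed

lemma has_vector_derivative_Im_line:
  fixes w :: "complex \<Rightarrow> complex"
  shows "((\<lambda>t. w (z + t *\<^sub>R \<i>)) has_vector_derivative a) (at 0) \<longleftrightarrow>
    ((\<lambda>y. w (Complex (Re z) y)) has_vector_derivative a) (at (Im z))"
    (is "?L \<longleftrightarrow> ?R")
proof -
  have e1: "Complex (Re z) y = z + (y - Im z) *\<^sub>R \<i>"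
    and e2: "z + t *\<^sub>R \<i> = Complex (Re z) (Im z + t)" for y t
    by (simp_all add: complex_eq_iff)
  show ?thesis
  proof
    assume ?L
    then have "((\<lambda>t. w (z + t *\<^sub>R \<i>)) \<circ> (\<lambda>y. y - Im z) has_vector_derivative 1 *\<^sub>R a) (at (Im z))"
      by (intro vector_diff_chain_at) (auto intro!: derivative_eq_intros)
    then show ?R by (simp only: o_def e1 scaleR_one)
  next
    assume ?R
    then have "((\<lambda>y. w (Complex (Re z) y)) \<circ> (\<lambda>t. Im z + t) has_vector_derivative 1 *\<^sub>R a) (at 0)"
      by (intro vector_diff_chain_at) (auto intro!: derivative_eq_intros)
    then show ?L by (simp only: o_def e2 scaleR_one)
  qed
qed

text \<open>The classical criterion for total differentiability in its asymmetric form: the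
  x-partial is used at \<open>z\<close> alone, the y-partial is controlled nearby through continuity
  of \<open>b\<close>. It upgrades the partial derivatives of \<open>u\<close> and of its conjugate
  to real derivatives.\<close>

lemma has_derivative_if_continuous_partials:
  fixes w b :: "complex \<Rightarrow> complex"
  assumes S: "open S" "z \<in> S"
    and wx: "((\<lambda>t. w (z + t *\<^sub>R 1)) has_vector_derivative a) (at 0)"
    and wy: "\<And>z. z \<in> S \<Longrightarrow> ((\<lambda>t. w (z + t *\<^sub>R \<i>)) has_vector_derivative b z) (at 0)"
    and b: "continuous_on S b"
  shows "(w has_derivative (\<lambda>h. Re h *\<^sub>R a + Im h *\<^sub>R b z)) (at z)"
proof -
  obtain d where d: "d > 0" "ball z d \<subseteq> S"
    using S open_contains_ball by blast
  \<comment> \<open>Half of \<open>d\<close> in each coordinate keeps the box inside the ball,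
    because the modulus is at most the sum of the two coordinate distances.\<close>
  define X where "X = {Re z - d / 2 <..< Re z + d / 2}"
  define Y where "Y = {Im z - d / 2 <..< Im z + d / 2}"
  have box: "Complex x y \<in> S" if "x \<in> X" "y \<in> Y" for x y
  proof -
    have "cmod (z - Complex x y) \<le> \<bar>Re z - x\<bar> + \<bar>Im z - y\<bar>"
      using cmod_le[of "z - Complex x y"] by simp
    also have "\<dots> < d"
      using that by (auto simp: X_def Y_def abs_if)
    finally show ?thesis using d by (auto simp: dist_norm)
  qed
  have z_in: "Re z \<in> X" "Im z \<in> Y" using d by (auto simp: X_def Y_def)
  have fx: "((\<lambda>x. w (Complex x (Im z))) has_derivative (\<lambda>h. h *\<^sub>R a)) (at (Re z) within X)"
    using wx unfolding has_vector_derivative_Re_line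
    by (auto simp: has_vector_derivative_def intro: has_derivative_at_withinI)
  have fy: "((\<lambda>y. w (Complex x y)) has_derivative
      blinfun_apply (blinfun_scaleR_left (b (Complex x y)))) (at y within Y)"
    if "x \<in> X" "y \<in> Y" for x y
    using wy[OF box[OF that]] unfolding has_vector_derivative_Im_line
    by (auto simp: has_vector_derivative_def intro: has_derivative_at_withinI)
  have cont: "continuous (at (Re z, Im z) within X \<times> Y) (\<lambda>(x, y). blinfun_scaleR_left (b (Complex x y)))"
  proof -
    have "continuous_on (X \<times> Y) (\<lambda>p. b (Complex (fst p) (snd p)))"
      by (rule continuous_on_compose2[OF b]) (auto intro!: continuous_intros box)
    then have "continuous_on (X \<times> Y) (\<lambda>(x, y). blinfun_scaleR_left (b (Complex x y)))"
      by (auto simp: case_prod_unfold intro!: continuous_intros)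
    then show ?thesis
      using z_in by (auto simp: continuous_on_eq_continuous_within)
  qed
  have "((\<lambda>(x, y). w (Complex x y)) has_derivative
          (\<lambda>(tx, ty). tx *\<^sub>R a + blinfun_apply (blinfun_scaleR_left (b (Complex (Re z) (Im z)))) ty))
        (at (Re z, Im z) within X \<times> Y)"
    by (rule has_derivative_partialsI[OF fx fy cont]) (use z_in in \<open>auto simp: Y_def\<close>)
  then have D: "((\<lambda>(x, y). w (Complex x y)) has_derivative (\<lambda>(tx, ty). tx *\<^sub>R a + ty *\<^sub>R b z))
        (at (Re z, Im z))"
    using z_in by (subst (asm) at_within_open) (auto simp: X_def Y_def intro!: open_Times)
  have "((\<lambda>z. (Re z, Im z)) has_derivative (\<lambda>h. (Re h, Im h))) (at z)"
    by (auto intro!: derivative_eq_intros)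
  from diff_chain_at[OF this D] show ?thesis
    by (simp add: o_def case_prod_unfold)
qed

text \<open>The conjugate function \<open>v\<close> is built by integrating the partial derivatives of \<open>u\<close> from the
  corner of the quadrant, so that symmetry of the mixed second derivatives is not needed. As \<open>u\<close> may be
  complex-valued, \<open>u + \<i> v\<close> and \<open>u - \<i> v\<close> are unrelated: the first is holomorphic and the second
  antiholomorphic.\<close>

lemma harmonic_on_decompose:
  assumes u: "harmonic_on S u"
    and sub: "{z. Re z \<ge> p \<and> Im z \<ge> q} \<subseteq> S"
  obtains g h where "g holomorphic_on {z. Re z > p \<and> Im z > q}"
    "h holomorphic_on {z. Re z > p \<and> Im z > q}"
    "\<And>z. Re z > p \<Longrightarrow> Im z > q \<Longrightarrow> u z = g z + cnj (h z)"
proof -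
  define Q where "Q = {z. Re z > p \<and> Im z > q}"
  have Q_eq: "Q = {z. Re z > p} \<inter> {z. Im z > q}" by (auto simp: Q_def)
  have "open Q" unfolding Q_eq by (intro open_Int open_halfspace_Re_gt open_halfspace_Im_gt)
  define ux where "ux = dir_deriv 1 u"
  define uy where "uy = dir_deriv \<i> u"
  define uxx where "uxx = dir_deriv 1 ux"
  define uyy where "uyy = dir_deriv \<i> uy"
  have "open S" and C2: "Ck_on 2 S u" and lap: "\<And>z. z \<in> S \<Longrightarrow> uxx z + uyy z = 0"
    using u by (auto simp: harmonic_on_def laplacian_def uxx_def uyy_def ux_def uy_def)
  have *: "Ck_on 2 S u = Ck_on (Suc (Suc 0)) S u" by (simp add: numeral_2_eq_2)
  have D: "((\<lambda>t. u (z + t *\<^sub>R 1)) has_vector_derivative ux z) (at 0)"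
    "((\<lambda>t. u (z + t *\<^sub>R \<i>)) has_vector_derivative uy z) (at 0)"
    "((\<lambda>t. ux (z + t *\<^sub>R 1)) has_vector_derivative uxx z) (at 0)"
    "((\<lambda>t. uy (z + t *\<^sub>R \<i>)) has_vector_derivative uyy z) (at 0)" if "z \<in> S" for z
    using C2 that unfolding * Ck_on.simps ux_def uy_def uxx_def uyy_def
    by (auto simp: dir_deriv_def vector_derivative_works)
  have cont: "continuous_on S ux" "continuous_on S uy" "continuous_on S uxx" "continuous_on S uyy"
    using C2 unfolding * Ck_on.simps ux_def uy_def uxx_def uyy_def by auto
  have ux_line: "((\<lambda>x. ux (Complex x y)) has_vector_derivative uxx (Complex x y)) (at x)"
    if "Complex x y \<in> S" for x y
    using D(3)[OF that] unfolding has_vector_derivative_Re_line by simp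
  have uy_line: "((\<lambda>y. uy (Complex x y)) has_vector_derivative uyy (Complex x y)) (at y)"
    if "Complex x y \<in> S" for x y
    using D(4)[OF that] unfolding has_vector_derivative_Im_line by simp
  have inS: "Complex x y \<in> S" if "x \<ge> p" "y \<ge> q" for x y
    using sub that by auto
  have cont_line:
    "continuous_on {q..y} (\<lambda>t. ux (Complex x t))"
    "continuous_on {p..x'} (\<lambda>s. uy (Complex s q))" if "x \<ge> p" for x y x'
    by (rule continuous_on_compose2[OF cont(1)] continuous_on_compose2[OF cont(2)];
        use that in \<open>auto intro!: continuous_intros inS\<close>)+
  \<comment> \<open>\<open>v\<close> is the integral of \<open>ux dy - uy dx\<close> from the corner
    \<open>(p, q)\<close>: first along the bottom edge, which contributes \<open>- J\<close>, then
    vertically, which contributes \<open>I\<close>.\<close>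
  define I where "I = (\<lambda>x y. integral {q..y} (\<lambda>t. ux (Complex x t)))"
  define J where "J = (\<lambda>x. integral {p..x} (\<lambda>s. uy (Complex s q)))"
  define v where "v = (\<lambda>z. I (Re z) (Im z) - J (Re z))"
  have J': "(J has_vector_derivative uy (Complex x q)) (at x)" if "x > p" for x
  proof -
    \<comment> \<open>The right end \<open>x + 1\<close> makes \<open>x\<close> an interior point,
      so the derivative within the interval is the two-sided one.\<close>
    have "(J has_vector_derivative uy (Complex x q)) (at x within {p..x+1})"
      unfolding J_def
      by (rule integral_has_vector_derivative[OF cont_line(2)]) (use that in auto)
    then show ?thesis
      using that by (simp add: at_within_Icc_at)
  qed
  have Iy: "(I x has_vector_derivative ux (Complex x y)) (at y)" if "x > p" "y > q" for x y
  proof -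
    have "(I x has_vector_derivative ux (Complex x y)) (at y within {q..y+1})"
      unfolding I_def
      by (rule integral_has_vector_derivative[OF cont_line(1)]) (use that in auto)
    then show ?thesis
      using that by (simp add: at_within_Icc_at)
  qed
  \<comment> \<open>Harmonicity enters here: differentiation under the integral produces
    \<open>uxx = - uyy\<close>, which is then integrated in y. The boundary term at height
    \<open>q\<close> will cancel against the derivative of \<open>J\<close>.\<close>
  have Ix: "((\<lambda>x. I x y) has_vector_derivative uy (Complex x q) - uy (Complex x y)) (at x)"
    if "x > p" "y > q" for x y
  proof -
    have "((\<lambda>x. integral (cbox q y) (\<lambda>t. ux (Complex x t))) has_vector_derivative
            integral (cbox q y) (\<lambda>t. uxx (Complex x t))) (at x within {p<..})"
    proof (rule leibniz_rule_vector_derivative)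
      show "((\<lambda>x. ux (Complex x t)) has_vector_derivative uxx (Complex x t)) (at x within {p<..})"
        if "x \<in> {p<..}" "t \<in> cbox q y" for x t
        using that by (intro has_vector_derivative_at_within[OF ux_line] inS) auto
      show "(\<lambda>t. ux (Complex x t)) integrable_on cbox q y" if "x \<in> {p<..}" for x
        using that cont_line(1)[of x y] by (auto intro!: integrable_continuous_real)
      show "continuous_on ({p<..} \<times> cbox q y) (\<lambda>(x, t). uxx (Complex x t))"
        unfolding case_prod_unfold
        by (rule continuous_on_compose2[OF cont(3)]) (auto intro!: continuous_intros inS)
    qed (use that in auto)
    moreover have "((\<lambda>t. uyy (Complex x t)) has_integral (uy (Complex x y) - uy (Complex x q))) {q..y}"
      by (rule fundamental_theorem_of_calculus)
        (use that in \<open>auto intro!: has_vector_derivative_at_within[OF uy_line] inS\<close>)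
    then have "((\<lambda>t. - uyy (Complex x t)) has_integral - (uy (Complex x y) - uy (Complex x q))) {q..y}"
      by (rule has_integral_neg)
    then have "((\<lambda>t. uxx (Complex x t)) has_integral - (uy (Complex x y) - uy (Complex x q))) {q..y}"
      by (rule has_integral_eq[rotated])
        (use that lap inS in \<open>auto simp: eq_neg_iff_add_eq_0 add.commute neg_eq_iff_add_eq_0\<close>)
    ultimately show ?thesis
      using that by (simp add: I_def integral_unique at_within_open[OF _ open_greaterThan])
  qed
  have vx: "((\<lambda>t. v (z + t *\<^sub>R 1)) has_vector_derivative - uy z) (at 0)" if "z \<in> Q" for z
  proof -
    have "((\<lambda>x. I x (Im z) - J x) has_vector_derivative
        (uy (Complex (Re z) q) - uy (Complex (Re z) (Im z))) - uy (Complex (Re z) q)) (at (Re z))"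
      by (rule has_vector_derivative_diff[OF Ix J']) (use that in \<open>auto simp: Q_def\<close>)
    then show ?thesis
      unfolding has_vector_derivative_Re_line by (simp add: v_def)
  qed
  have vy: "((\<lambda>t. v (z + t *\<^sub>R \<i>)) has_vector_derivative ux z) (at 0)" if "z \<in> Q" for z
  proof -
    have "((\<lambda>y. I (Re z) y - J (Re z)) has_vector_derivative ux (Complex (Re z) (Im z)) - 0) (at (Im z))"
      by (rule has_vector_derivative_diff[OF Iy]) (use that in \<open>auto simp: Q_def\<close>)
    then show ?thesis
      unfolding has_vector_derivative_Im_line by (simp add: v_def)
  qed
  have QS: "Q \<subseteq> S" using sub by (auto simp: Q_def)
  have u': "(u has_derivative (\<lambda>h. Re h *\<^sub>R ux z + Im h *\<^sub>R uy z)) (at z)" if "z \<in> Q" for z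
    by (rule has_derivative_if_continuous_partials[OF \<open>open S\<close>]) (use that QS D cont in auto)
  have v': "(v has_derivative (\<lambda>h. Re h *\<^sub>R (- uy z) + Im h *\<^sub>R ux z)) (at z)" if "z \<in> Q" for z
    by (rule has_derivative_if_continuous_partials[OF \<open>open Q\<close>])
      (use that vx vy continuous_on_subset[OF cont(1) QS] in auto)
  \<comment> \<open>The partial derivatives of \<open>u\<close> and \<open>v\<close> satisfy the
    Cauchy-Riemann equations. Conjugating the antiholomorphic half makes \<open>h\<close>
    holomorphic, and \<open>g + cnj h\<close> is \<open>u\<close>.\<close>
  define g where "g = (\<lambda>z. (u z + \<i> * v z) / 2)"
  define h where "h = (\<lambda>z. cnj ((u z - \<i> * v z) / 2))"
  have g': "(g has_field_derivative (ux z - \<i> * uy z) / 2) (at z)" if "z \<in> Q" for z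
    unfolding g_def has_field_derivative_def
    apply (rule has_derivative_eq_rhs)
     apply (rule derivative_eq_intros u'[OF that] v'[OF that] refl | simp)+
    by (auto simp: fun_eq_iff complex_eq_iff field_simps)
  have h': "(h has_field_derivative cnj ((ux z + \<i> * uy z) / 2)) (at z)" if "z \<in> Q" for z
    unfolding h_def has_field_derivative_def
    apply (rule has_derivative_eq_rhs)
     apply (rule derivative_eq_intros u'[OF that] v'[OF that] refl | simp)+
    by (auto simp: fun_eq_iff complex_eq_iff field_simps)
  show ?thesis
  proof (rule that[of g h])
    show "g holomorphic_on {z. Re z > p \<and> Im z > q}" "h holomorphic_on {z. Re z > p \<and> Im z > q}"
      using g' h' unfolding Q_def[symmetric] holomorphic_on_open[OF \<open>open Q\<close>] by blast+
  qed (simp add: g_def h_def field_simps)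
qed

section \<open>Half-circle integrals and the radial dependence of sine coefficients\<close>

text \<open>The fundamental theorem of calculus along \<open>rcis r t\<close>. The primitive has to
  be differentiable also at the two endpoints on the real axis; the vertical shift made later
  provides this.\<close>

lemma has_integral_semicircle:
  fixes F f :: "complex \<Rightarrow> complex"
  assumes r: "r > 0"
    and F: "\<And>z. cmod z = r \<Longrightarrow> Im z \<ge> 0 \<Longrightarrow> (F has_field_derivative f z) (at z)"
  shows "((\<lambda>t. \<i> * rcis r t * f (rcis r t)) has_integral (F (- of_real r) - F (of_real r))) {0..pi}"
proof -
  have "((\<lambda>t. \<i> * rcis r t * f (rcis r t)) has_integral (F (rcis r pi) - F (rcis r 0))) {0..pi}"
  proof (rule fundamental_theorem_of_calculus)
    fix t assume t: "t \<in> {0..pi}"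
    have "((\<lambda>t. rcis r t) has_vector_derivative \<i> * rcis r t) (at t within {0..pi})"
      unfolding rcis_def cis_conv_exp
      by (rule has_vector_derivative_real_field[of "\<lambda>z. of_real r * exp (\<i> * z)"])
        (auto intro!: derivative_eq_intros)
    moreover have "(F has_field_derivative f (rcis r t)) (at (rcis r t))"
      using r t by (intro F) (auto simp: sin_ge_zero)
    ultimately have "(F \<circ> (\<lambda>t. rcis r t) has_vector_derivative \<i> * rcis r t * f (rcis r t)) (at t within {0..pi})"
      by (rule field_vector_diff_chain_within[OF _ has_field_derivative_at_within])
    then show "((\<lambda>t. F (rcis r t)) has_vector_derivative \<i> * rcis r t * f (rcis r t)) (at t within {0..pi})"
      by (simp add: o_def)
  qed simp
  then show ?thesis
    by (simp add: rcis_def)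
qed

text \<open>On the real axis, where \<open>m\<close> is real, the endpoint difference below has a derivative depending
  only on \<open>g + cnj h\<close>, although neither \<open>g\<close> nor \<open>h\<close> is controlled separately.\<close>

lemma has_integral_semicircle_pair:
  fixes F H g h m :: "complex \<Rightarrow> complex"
  assumes "r > 0"
    and "\<And>z. cmod z = r \<Longrightarrow> Im z \<ge> 0 \<Longrightarrow> (F has_field_derivative g z * m z) (at z)"
    and "\<And>z. cmod z = r \<Longrightarrow> Im z \<ge> 0 \<Longrightarrow> (H has_field_derivative h z * m z) (at z)"
  shows "((\<lambda>t. \<i> * (g (rcis r t) * (rcis r t * m (rcis r t)) - cnj (h (rcis r t) * (rcis r t * m (rcis r t)))))
     has_integral (F (- of_real r) - F (of_real r) + cnj (H (- of_real r) - H (of_real r)))) {0..pi}"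
proof -
  have "((\<lambda>t. \<i> * rcis r t * (g (rcis r t) * m (rcis r t))) has_integral (F (- of_real r) - F (of_real r))) {0..pi}"
    and "((\<lambda>t. \<i> * rcis r t * (h (rcis r t) * m (rcis r t))) has_integral (H (- of_real r) - H (of_real r))) {0..pi}"
    using assms by (intro has_integral_semicircle; blast)+
  \<comment> \<open>Conjugation turns the factor \<open>\<i>\<close> into \<open>- \<i>\<close>:
    hence a difference in the integrand but a sum of endpoint terms.\<close>
  from has_integral_add[OF this(1) has_integral_cnj[THEN iffD2, OF this(2)]] show ?thesis
    by (simp add: algebra_simps o_def)
qed

text \<open>The mean value inequality for \<open>E\<close>: as \<open>m\<close> is real on the axis,
  the derivative \<open>E'\<close> contains \<open>g\<close> and \<open>h\<close> only in the
  combination \<open>g + cnj h\<close>, at \<open>x\<close> and at \<open>-x\<close>. Each of these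
  two points contributes at most \<open>\<delta> * M\<close>.\<close>

lemma endpoint_difference_pair_bound:
  fixes F H g h m :: "complex \<Rightarrow> complex"
  assumes ab: "a \<le> b"
    and F: "\<And>x::real. a \<le> \<bar>x\<bar> \<Longrightarrow> \<bar>x\<bar> \<le> b \<Longrightarrow> (F has_field_derivative g x * m x) (at (of_real x))"
    and H: "\<And>x::real. a \<le> \<bar>x\<bar> \<Longrightarrow> \<bar>x\<bar> \<le> b \<Longrightarrow> (H has_field_derivative h x * m x) (at (of_real x))"
    and m: "\<And>x::real. a \<le> \<bar>x\<bar> \<Longrightarrow> \<bar>x\<bar> \<le> b \<Longrightarrow> m x \<in> \<real> \<and> cmod (m x) \<le> M"
    and \<delta>: "\<And>x::real. a \<le> \<bar>x\<bar> \<Longrightarrow> \<bar>x\<bar> \<le> b \<Longrightarrow> cmod (g x + cnj (h x)) \<le> \<delta>"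
    and "0 \<le> a"
    and E: "E = (\<lambda>r::real. F (- of_real r) - F (of_real r) + cnj (H (- of_real r) - H (of_real r)))"
  shows "cmod (E b - E a) \<le> 2 * \<delta> * M * (b - a)"
proof -
  define E' where "E' = (\<lambda>x::real. - ((g (-x) + cnj (h (-x))) * m (-x) + (g x + cnj (h x)) * m x))"
  have der: "((\<lambda>r. F (c * of_real r)) has_vector_derivative c * (g (c * of_real x) * m (c * of_real x))) (at x)"
    "((\<lambda>r. H (c * of_real r)) has_vector_derivative c * (h (c * of_real x) * m (c * of_real x))) (at x)"
    if x: "x \<in> {a..b}" and c: "c = 1 \<or> c = -1" for x c
  proof -
    \<comment> \<open>Writing \<open>c * x\<close> as a real number \<open>y\<close> of modulus
      \<open>x\<close> treats both ends of the half circle at once.\<close>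
    obtain y :: real where y: "c * of_real x = of_real y" "\<bar>y\<bar> = x"
      using c x \<open>0 \<le> a\<close> by (metis abs_minus_cancel abs_of_nonneg atLeastAtMost_iff mult_1 mult_minus1 of_real_minus order_trans)
    have *: "((\<lambda>r. c * of_real r) has_vector_derivative c) (at x)"
      by (auto intro!: derivative_eq_intros)
    show "((\<lambda>r. F (c * of_real r)) has_vector_derivative c * (g (c * of_real x) * m (c * of_real x))) (at x)"
      using field_vector_diff_chain_at[OF *, of F "g y * m y"] F[of y] x y by (simp add: o_def)
    show "((\<lambda>r. H (c * of_real r)) has_vector_derivative c * (h (c * of_real x) * m (c * of_real x))) (at x)"
      using field_vector_diff_chain_at[OF *, of H "h y * m y"] H[of y] x y by (simp add: o_def)
  qed
  have E'_eq: "(E has_vector_derivative E' x) (at x)" if x: "x \<in> {a..b}" for x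
  proof -
    have mr: "cnj (m x) = m x" "cnj (m (- of_real x)) = m (- of_real x)"
      using m[of x] m[of "-x"] x \<open>0 \<le> a\<close> by (auto simp: complex_is_Real_iff complex_eq_iff)
    have F1: "((\<lambda>r. F (of_real r)) has_vector_derivative g x * m x) (at x)"
      and H1: "((\<lambda>r. H (of_real r)) has_vector_derivative h x * m x) (at x)"
      using der[OF x, of 1] by simp_all
    have F2: "((\<lambda>r. F (- of_real r)) has_vector_derivative - (g (-x) * m (-x))) (at x)"
      and H2: "((\<lambda>r. H (- of_real r)) has_vector_derivative - (h (-x) * m (-x))) (at x)"
      using der[OF x, of "-1"] by simp_all
    have eq: "- (g (-x) * m (-x)) - g x * m x + cnj (- (h (-x) * m (-x)) - h x * m x) = E' x"
      by (simp add: E'_def algebra_simps mr)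
    show ?thesis
      unfolding E eq[symmetric]
      by (intro has_vector_derivative_add has_vector_derivative_diff F1 F2 H1 H2 has_vector_derivative_cnj)
  qed
  have "cmod (E' x) \<le> 2 * \<delta> * M" if x: "x \<in> {a..b}" for x
  proof -
    have x': "a \<le> \<bar>x\<bar>" "\<bar>x\<bar> \<le> b" "a \<le> \<bar>-x\<bar>" "\<bar>-x\<bar> \<le> b" using x \<open>0 \<le> a\<close> by auto
    have "0 \<le> \<delta>" using \<delta>[OF x'(1,2)] norm_ge_zero order_trans by blast
    have "cmod (E' x) \<le> cmod ((g (-x) + cnj (h (-x))) * m (-x)) + cmod ((g x + cnj (h x)) * m x)"
      unfolding E'_def norm_minus_cancel of_real_minus by (rule norm_triangle_ineq)
    also have "\<dots> \<le> \<delta> * M + \<delta> * M"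
      unfolding norm_mult
      using \<delta>[OF x'(1,2)] \<delta>[OF x'(3,4)] m[OF x'(1,2)] m[OF x'(3,4)] \<open>0 \<le> \<delta>\<close>
      by (intro add_mono mult_mono) auto
    finally show ?thesis by (simp add: algebra_simps)
  qed
  then have "onorm (\<lambda>s. s *\<^sub>R E' x) \<le> 2 * \<delta> * M" if "x \<in> {a..b}" for x
    using that by (simp add: onorm_scaleR_left onorm_id)
  then have "norm (E b - E a) \<le> (2 * \<delta> * M) * norm (b - a)"
    using E'_eq[unfolded has_vector_derivative_def] ab
    by (intro differentiable_bound[where S="{a..b}" and f'="\<lambda>x s. s *\<^sub>R E' x"])
       (auto intro: has_derivative_at_withinI)
  then show ?thesis using ab by simp
qed

text \<open>A segment from \<open>\<i>\<close> to a point off the slit meets the imaginary axis only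
  at positive height. The slit contains the pole of \<open>1 / z ^ (k + 1)\<close> and avoids the
  closed upper half circles around 0, so a primitive on the slit domain can be evaluated at both of
  their ends.\<close>

lemma starlike_minus_negative_imaginary_axis:
  assumes "convex T" "\<i> \<in> T"
  shows "starlike (T - {z. Re z = 0 \<and> Im z \<le> 0})"
  unfolding starlike_def
proof (intro bexI ballI subsetI)
  fix z w
  assume z: "z \<in> T - {z. Re z = 0 \<and> Im z \<le> 0}" and w: "w \<in> closed_segment \<i> z"
  from w obtain s where s: "0 \<le> s" "s \<le> 1" "w = (1 - s) *\<^sub>R \<i> + s *\<^sub>R z"
    by (auto simp: in_segment)
  have "w \<in> T"
    using s z assms unfolding s(3) by (intro convexD) auto
  moreover have "Im w > 0" if "Re w = 0"
  proof (cases "s = 0")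
    case False
    then have "Re z = 0" using that s by simp
    then have "Im z > 0" using z by auto
    then have "s * Im z > 0" using False s by simp
    then show ?thesis using s by simp
  qed (use s in simp)
  ultimately show "w \<in> T - {z. Re z = 0 \<and> Im z \<le> 0}"
    by auto
qed (use assms in auto)

text \<open>Shifting by \<open>\<i> \<epsilon>\<close> makes \<open>g\<close> and \<open>h\<close> holomorphic up to the boundary. With \<open>m z = z ^ (k - 1)\<close>
  the endpoint difference \<open>E1\<close> is small, and with \<open>m z = 1 / z ^ (k + 1)\<close> the endpoint difference \<open>E2\<close> is
  nearly independent of \<open>r\<close>. The sine coefficient of the shifted function is
  \<open>(r ^ k * E2 r - E1 r / r ^ k) / 2\<close>, so in the limit only a multiple of \<open>r ^ k\<close> survives.\<close>

lemma sine_coefficient_homogeneous: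
  fixes U :: "complex \<Rightarrow> complex"
  defines "B \<equiv> (\<lambda>k r. integral {0..pi} (\<lambda>t. U (rcis r t) * sin (real k * t)))"
  assumes k: "k \<ge> 1"
    and contU: "continuous_on UNIV U"
    and U0: "\<And>x::real. U (of_real x) = 0"
    and dec: "\<And>p q. q > 0 \<Longrightarrow> \<exists>g h. g holomorphic_on {z. Re z > p \<and> Im z > q} \<and>
       h holomorphic_on {z. Re z > p \<and> Im z > q} \<and>
       (\<forall>z. Re z > p \<longrightarrow> Im z > q \<longrightarrow> U z = g z + cnj (h z))"
    and r: "0 < r" "r \<le> R"
  shows "B k r / of_real r ^ k = B k R / of_real R ^ k"
proof -
  have "R > 0" using r by simp
  \<comment> \<open>\<open>C\<close> is read off from the last estimate of \<open>main\<close>: two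
    approximation errors \<open>D\<close>, the change of \<open>E2\<close>, and two terms with
    \<open>E1\<close>. What matters is that it is positive and independent of
    \<open>\<delta>\<close>.\<close>
  define C where "C = 2 * pi / r ^ k + (inverse (r ^ (k + 1)) * (R - r) + 2 * R ^ k / (r ^ k)\<^sup>2)"
  have "C > 0"
  proof -
    have "2 * pi / r ^ k > 0" using r by simp
    moreover have "inverse (r ^ (k + 1)) * (R - r) \<ge> 0" "2 * R ^ k / (r ^ k)\<^sup>2 \<ge> 0"
      using r by (auto intro!: mult_nonneg_nonneg divide_nonneg_nonneg)
    ultimately show ?thesis unfolding C_def by linarith
  qed
  have main: "cmod (B k r / of_real r ^ k - B k R / of_real R ^ k) \<le> C * \<delta>" if "\<delta> > 0" for \<delta>
  proof -
    have "uniformly_continuous_on (cball 0 (R + 1)) U"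
      by (intro compact_uniformly_continuous continuous_on_subset[OF contU]) auto
    then obtain d where d: "d > 0"
      "\<And>z w. z \<in> cball 0 (R + 1) \<Longrightarrow> w \<in> cball 0 (R + 1) \<Longrightarrow> dist w z < d \<Longrightarrow> dist (U w) (U z) < \<delta>"
      using \<open>\<delta> > 0\<close> unfolding uniformly_continuous_on_def by metis
    \<comment> \<open>The bound 1 keeps shifted points in the disc of radius \<open>R + 1\<close>;
      the bound \<open>d / 2\<close> makes the shift small enough for uniform continuity.\<close>
    define \<epsilon> where "\<epsilon> = min 1 (d / 2)"
    have \<epsilon>: "\<epsilon> > 0" "\<epsilon> \<le> 1" "\<epsilon> < d" using d(1) by (auto simp: \<epsilon>_def)
    have close: "cmod (U (z + \<i> * \<epsilon>) - U z) \<le> \<delta>" if "cmod z \<le> R" for z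
    proof -
      have "cmod (z + \<i> * \<epsilon>) \<le> R + 1"
        using norm_triangle_ineq[of z "\<i> * \<epsilon>"] that \<epsilon> by (simp add: norm_mult)
      then have "dist (U (z + \<i> * \<epsilon>)) (U z) < \<delta>"
        using that \<epsilon> by (intro d(2)) (simp_all add: mem_cball_0 dist_norm norm_mult del: mem_cball)
      then show ?thesis by (simp add: dist_norm)
    qed
    \<comment> \<open>The decomposition starts at height \<open>\<epsilon> / 2\<close>, so after the
      shift by \<open>\<epsilon>\<close> the domain \<open>T\<close> is a neighbourhood of the
      closed upper half disc of radius \<open>R\<close>.\<close>
    obtain g' h' where g'h': "g' holomorphic_on {z. Re z > - (R + 1) \<and> Im z > \<epsilon> / 2}"
       "h' holomorphic_on {z. Re z > - (R + 1) \<and> Im z > \<epsilon> / 2}"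
       "\<And>z. Re z > - (R + 1) \<Longrightarrow> Im z > \<epsilon> / 2 \<Longrightarrow> U z = g' z + cnj (h' z)"
      using dec[of "\<epsilon> / 2" "- (R + 1)"] \<epsilon> by auto
    define g where "g = (\<lambda>z. g' (z + \<i> * \<epsilon>))"
    define h where "h = (\<lambda>z. h' (z + \<i> * \<epsilon>))"
    define T where "T = {z. Re z > - (R + 1)} \<inter> {z. Im z > - (\<epsilon> / 2)}"
    have "convex T" "open T"
      unfolding T_def by (intro convex_Int convex_halfspace_Re_gt convex_halfspace_Im_gt
        open_Int open_halfspace_Re_gt open_halfspace_Im_gt)+
    have hol: "g holomorphic_on T" "h holomorphic_on T"
      unfolding g_def h_def
      by (rule holomorphic_on_compose_gen[unfolded o_def, OF _ g'h'(1)]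
               holomorphic_on_compose_gen[unfolded o_def, OF _ g'h'(2)];
          auto intro!: holomorphic_intros simp: T_def)+
    have w: "g z + cnj (h z) = U (z + \<i> * \<epsilon>)" if "z \<in> T" for z
      using that g'h'(3)[of "z + \<i> * \<epsilon>"] by (auto simp: g_def h_def T_def)
    have semidisc: "z \<in> T" if "cmod z \<le> R" "Im z \<ge> 0" for z
      using that abs_Re_le_cmod[of z] \<epsilon> by (auto simp: T_def)
    define N where "N = {z. Re z = 0 \<and> Im z \<le> 0}"
    have "closed N"
      unfolding N_def
      by (intro closed_Collect_conj closed_Collect_eq closed_Collect_le continuous_intros)
    then have "open (T - N)" using \<open>open T\<close> by blast
    have "starlike (T - N)"
      unfolding N_def using \<open>convex T\<close>
      by (rule starlike_minus_negative_imaginary_axis) (use \<open>R > 0\<close> \<epsilon> in \<open>auto simp: T_def\<close>)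
    have prim1: "\<exists>F. \<forall>z\<in>T. (F has_field_derivative f z * z ^ (k - 1)) (at z)"
      if "f holomorphic_on T" for f
    proof -
      have "(\<lambda>z. f z * z ^ (k - 1)) holomorphic_on T"
        by (intro holomorphic_intros that)
      then obtain F where "\<And>z. z \<in> T \<Longrightarrow> (F has_field_derivative f z * z ^ (k - 1)) (at z within T)"
        using holomorphic_convex_primitive'[OF \<open>convex T\<close> \<open>open T\<close>] by blast
      then show ?thesis by (metis \<open>open T\<close> at_within_open)
    qed
    have prim2: "\<exists>F. \<forall>z\<in>T - N. (F has_field_derivative f z * inverse (z ^ (k + 1))) (at z)"
      if "f holomorphic_on T" for f
    proof (rule holomorphic_starlike_primitive[OF _ \<open>starlike (T - N)\<close> \<open>open (T - N)\<close> finite.emptyI])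
      have *: "(\<lambda>z. f z * inverse (z ^ (k + 1))) holomorphic_on (T - N)"
        by (intro holomorphic_intros holomorphic_on_subset[OF that]) (auto simp: N_def)
      then show "continuous_on (T - N) (\<lambda>z. f z * inverse (z ^ (k + 1)))"
        by (rule holomorphic_on_imp_continuous_on)
      show "(\<lambda>z. f z * inverse (z ^ (k + 1))) field_differentiable at z" if "z \<in> T - N - {}" for z
        using holomorphic_on_imp_differentiable_at[OF * \<open>open (T - N)\<close>] that by simp
    qed
    obtain F1 H1 F2 H2 where prims:
      "\<And>z. z \<in> T \<Longrightarrow> (F1 has_field_derivative g z * z ^ (k - 1)) (at z)"
      "\<And>z. z \<in> T \<Longrightarrow> (H1 has_field_derivative h z * z ^ (k - 1)) (at z)"
      "\<And>z. z \<in> T - N \<Longrightarrow> (F2 has_field_derivative g z * inverse (z ^ (k + 1))) (at z)"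
      "\<And>z. z \<in> T - N \<Longrightarrow> (H2 has_field_derivative h z * inverse (z ^ (k + 1))) (at z)"
      using prim1[OF hol(1)] prim1[OF hol(2)] prim2[OF hol(1)] prim2[OF hol(2)] by metis
    define E1 where "E1 = (\<lambda>r::real. F1 (- of_real r) - F1 (of_real r) + cnj (H1 (- of_real r) - H1 (of_real r)))"
    define E2 where "E2 = (\<lambda>r::real. F2 (- of_real r) - F2 (of_real r) + cnj (H2 (- of_real r) - H2 (of_real r)))"
    \<comment> \<open>The boundary values enter here: \<open>U\<close> vanishes at \<open>x\<close>,
      so the shifted value is small.\<close>
    have bdry: "cmod (g x + cnj (h x)) \<le> \<delta>" if "\<bar>x\<bar> \<le> R" for x :: real
      using close[of x] that by (subst w) (auto intro: semidisc simp: U0)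
    have E1_bound: "cmod (E1 s) \<le> 2 * \<delta> * R ^ k" if s: "0 < s" "s \<le> R" for s
    proof -
      \<comment> \<open>\<open>E1 0\<close> vanishes because its endpoints coincide, so a bound for
        the increment is a bound for \<open>E1 s\<close>.\<close>
      have "cmod (E1 s - E1 0) \<le> 2 * \<delta> * R ^ (k - 1) * (s - 0)"
      proof (rule endpoint_difference_pair_bound[OF _ _ _ _ _ _ E1_def, where m = "\<lambda>z. z ^ (k - 1)"])
        show "complex_of_real x ^ (k - 1) \<in> \<real> \<and> cmod (complex_of_real x ^ (k - 1)) \<le> R ^ (k - 1)"
          if "\<bar>x\<bar> \<le> s" for x
          using that s by (auto simp: norm_power intro!: power_mono)
      qed (use s in \<open>auto intro!: prims(1,2)[simplified] bdry semidisc\<close>)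
      also have "\<dots> \<le> 2 * \<delta> * R ^ (k - 1) * R"
        using s \<open>\<delta> > 0\<close> \<open>R > 0\<close> by (intro mult_left_mono) auto
      also have "\<dots> = 2 * \<delta> * R ^ k"
        using k power_minus_mult[of k R] by (simp add: mult.assoc)
      finally show ?thesis by (simp add: E1_def)
    qed
    have E2_bound: "cmod (E2 R - E2 r) \<le> 2 * \<delta> * inverse (r ^ (k + 1)) * (R - r)"
    proof (rule endpoint_difference_pair_bound[OF _ _ _ _ _ _ E2_def, where m = "\<lambda>z. inverse (z ^ (k + 1))"])
      show "inverse (complex_of_real x ^ (k + 1)) \<in> \<real> \<and>
          cmod (inverse (complex_of_real x ^ (k + 1))) \<le> inverse (r ^ (k + 1))"
        if "r \<le> \<bar>x\<bar>" for x
        unfolding norm_inverse norm_power norm_of_real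
        using that r by (intro conjI le_imp_inverse_le power_mono) auto
    qed (use r in \<open>auto intro!: prims(3,4)[simplified] bdry semidisc simp: N_def\<close>)
    define J where "J = (\<lambda>s. (of_real s ^ k * E2 s - E1 s / of_real s ^ k) / 2)"
    have J: "((\<lambda>t. U (rcis s t + \<i> * \<epsilon>) * sin (real k * t)) has_integral J s) {0..pi}"
      if s: "0 < s" "s \<le> R" for s
    proof -
      define c where "c = complex_of_real s ^ k"
      have "c \<noteq> 0" using s by (simp add: c_def)
      have 1: "((\<lambda>t. \<i> * (g (rcis s t) * (rcis s t * rcis s t ^ (k - 1))
           - cnj (h (rcis s t) * (rcis s t * rcis s t ^ (k - 1))))) has_integral E1 s) {0..pi}"
        unfolding E1_def
        by (rule has_integral_semicircle_pair[where m = "\<lambda>z. z ^ (k - 1)"])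
          (use s in \<open>auto intro!: prims(1,2)[simplified] semidisc\<close>)
      have 2: "((\<lambda>t. \<i> * (g (rcis s t) * (rcis s t * inverse (rcis s t ^ (k + 1)))
           - cnj (h (rcis s t) * (rcis s t * inverse (rcis s t ^ (k + 1)))))) has_integral E2 s) {0..pi}"
        unfolding E2_def
        by (rule has_integral_semicircle_pair[where m = "\<lambda>z. inverse (z ^ (k + 1))"])
          (use s in \<open>auto intro!: prims(3,4)[simplified] semidisc simp: N_def complex_eq_iff cmod_def\<close>)
      have "((\<lambda>t. U (rcis s t + \<i> * \<epsilon>) * sin (real k * t)) has_integral
        (c * E2 s - inverse c * E1 s) * (1/2)) {0..pi}"
      proof (rule has_integral_eq[rotated, OF has_integral_mult_left[OF has_integral_diff[OF
              has_integral_mult_right[OF 2] has_integral_mult_right[OF 1]]]])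
        fix t assume t: "t \<in> {0..pi}"
        define e where "e = cis (real k * t)"
        have e: "cnj e = inverse e" "e \<noteq> 0" "e - inverse e = 2 * \<i> * sin (real k * t)"
          by (simp_all add: e_def cis_cnj) (simp add: complex_eq_iff)
        have ce: "rcis s t ^ k = c * e"
          by (simp add: e_def c_def rcis_def Complex.DeMoivre power_mult_distrib)
        have p: "rcis s t * rcis s t ^ (k - 1) = c * e"
          using k ce power_minus_mult[of k "rcis s t"] by (simp add: mult.commute)
        have "rcis s t \<noteq> 0" using s by simp
        then have q: "rcis s t * inverse (rcis s t ^ (k + 1)) = inverse c * inverse e"
          using ce by simp
        have "rcis s t \<in> T" using s t by (intro semidisc) (auto simp: sin_ge_zero)
        \<comment> \<open>Since \<open>c\<close> is real and \<open>cnj e = inverse e\<close>, the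
          two integrands combine so that \<open>g\<close> and \<open>cnj h\<close> receive the same
          factor. Their sum is the shifted \<open>U\<close>, the quantity under control.\<close>
        have "(c * (\<i> * (g (rcis s t) * (inverse c * inverse e) - cnj (h (rcis s t) * (inverse c * inverse e))))
           - inverse c * (\<i> * (g (rcis s t) * (c * e) - cnj (h (rcis s t) * (c * e))))) * (1 / 2)
           = - \<i> / 2 * (g (rcis s t) + cnj (h (rcis s t))) * (e - inverse e)"
          using \<open>c \<noteq> 0\<close> e(2) by (simp add: e(1) c_def field_simps)
        also have "\<dots> = U (rcis s t + \<i> * \<epsilon>) * sin (real k * t)"
          unfolding w[OF \<open>rcis s t \<in> T\<close>] e(3) by (simp add: complex_eq_iff)
        finally show "(c * (\<i> * (g (rcis s t) * (rcis s t * inverse (rcis s t ^ (k + 1)))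
           - cnj (h (rcis s t) * (rcis s t * inverse (rcis s t ^ (k + 1))))))
           - inverse c * (\<i> * (g (rcis s t) * (rcis s t * rcis s t ^ (k - 1))
           - cnj (h (rcis s t) * (rcis s t * rcis s t ^ (k - 1)))))) * (1 / 2)
           = U (rcis s t + \<i> * \<epsilon>) * sin (real k * t)"
          unfolding p q .
      qed
      then show ?thesis by (simp add: J_def c_def field_simps)
    qed
    have JB: "cmod (B k s - J s) \<le> \<delta> * pi" if s: "0 < s" "s \<le> R" for s
    proof -
      have "continuous_on {0..pi} (\<lambda>t. U (rcis s t) * sin (real k * t))"
        by (intro continuous_intros continuous_on_compose2[OF contU]) (auto simp: rcis_def)
      then have "((\<lambda>t. U (rcis s t) * sin (real k * t)) has_integral B k s) {0..pi}"
        unfolding B_def by (intro integrable_integral integrable_continuous_real)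
      from has_integral_diff[OF this J[OF s]]
      have "cmod (B k s - J s) \<le> \<delta> * measure lborel {0..pi}"
      proof (rule has_integral_bound_real[OF _ finite.emptyI, rotated])
        fix t assume "t \<in> {0..pi} - {}"
        have "cmod (U (rcis s t) * sin (real k * t) - U (rcis s t + \<i> * \<epsilon>) * sin (real k * t))
          = cmod (U (rcis s t + \<i> * \<epsilon>) - U (rcis s t)) * \<bar>sin (real k * t)\<bar>"
          by (simp flip: left_diff_distrib add: norm_mult norm_minus_commute)
        also have "\<dots> \<le> \<delta> * 1"
          using s \<open>\<delta> > 0\<close> by (intro mult_mono close) auto
        finally show "cmod (U (rcis s t) * sin (real k * t) - U (rcis s t + \<i> * \<epsilon>) * sin (real k * t)) \<le> \<delta>"
          by simp
      qed (use \<open>\<delta> > 0\<close> in simp)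
      then show ?thesis by simp
    qed
    define D where "D = (\<lambda>s. (B k s - J s) / of_real s ^ k)"
    have BD: "B k s / of_real s ^ k = D s + E2 s / 2 - E1 s / (of_real s ^ k)\<^sup>2 / 2"
      if s: "0 < s" for s
      using s by (simp add: D_def J_def field_simps power2_eq_square)
    have Db: "cmod (D s) \<le> \<delta> * pi / r ^ k" if s: "r \<le> s" "s \<le> R" for s
      unfolding D_def norm_divide norm_power norm_of_real
      using s r \<open>\<delta> > 0\<close> JB[of s] by (intro frac_le power_mono) auto
    have E1b: "cmod (E1 s / (of_real s ^ k)\<^sup>2 / 2) \<le> \<delta> * R ^ k / (r ^ k)\<^sup>2" if s: "r \<le> s" "s \<le> R" for s
    proof -
      have "cmod (E1 s / (of_real s ^ k)\<^sup>2) \<le> 2 * \<delta> * R ^ k / (r ^ k)\<^sup>2"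
        unfolding norm_divide norm_power norm_of_real
        using s r \<open>\<delta> > 0\<close> E1_bound[of s] by (intro frac_le power_mono) auto
      then show ?thesis by (simp add: norm_divide)
    qed
    have eq: "B k r / of_real r ^ k - B k R / of_real R ^ k
      = (D r - D R) - (E2 R - E2 r) / 2 - (E1 r / (of_real r ^ k)\<^sup>2 / 2 - E1 R / (of_real R ^ k)\<^sup>2 / 2)"
      using r by (simp add: BD algebra_simps diff_divide_distrib)
    have "cmod (B k r / of_real r ^ k - B k R / of_real R ^ k)
      \<le> (cmod (D r) + cmod (D R)) + cmod ((E2 R - E2 r) / 2)
        + (cmod (E1 r / (of_real r ^ k)\<^sup>2 / 2) + cmod (E1 R / (of_real R ^ k)\<^sup>2 / 2))"
      unfolding eq by (intro norm_triangle_le_diff add_mono order_refl)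
    also have "\<dots> \<le> (\<delta> * pi / r ^ k + \<delta> * pi / r ^ k) + \<delta> * inverse (r ^ (k + 1)) * (R - r)
        + (\<delta> * R ^ k / (r ^ k)\<^sup>2 + \<delta> * R ^ k / (r ^ k)\<^sup>2)"
      using E2_bound r by (intro add_mono Db E1b) (auto simp: norm_divide)
    also have "\<dots> = C * \<delta>"
      by (simp add: C_def algebra_simps)
    finally show ?thesis .
  qed
  have "cmod (B k r / of_real r ^ k - B k R / of_real R ^ k) \<le> 0"
  proof (rule field_le_epsilon)
    fix e :: real assume "e > 0"
    with main[of "e / C"] \<open>C > 0\<close>
    show "cmod (B k r / of_real r ^ k - B k R / of_real R ^ k) \<le> 0 + e" by simp
  qed
  then show ?thesis by simp
qed

section \<open>Vanishing of the coefficients of high order\<close>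

text \<open>Up to sign, multiplication by \<open>(2 * sin t)\<^sup>2\<close> is a second difference
  of step 2 in the frequency. The bound on \<open>k\<close> prevents truncation in
  \<open>k - 2\<close>.\<close>

lemma sin_square_sin_mult:
  assumes "k \<ge> 2"
  shows "4 * (sin t)\<^sup>2 * sin (real k * t) = 2 * sin (real k * t) - sin (real (k + 2) * t) - sin (real (k - 2) * t)"
proof -
  have 1: "real (k + 2) * t = real k * t + 2 * t" and 2: "real (k - 2) * t = real k * t - 2 * t"
    using assms by (simp_all add: algebra_simps)
  show ?thesis
    unfolding 1 2 sin_add sin_diff cos_double_sin by (simp add: algebra_simps)
qed

text \<open>The powers of \<open>sin t\<close> vanish at the endpoints and so compensate the growth of the integrand
  there; the price is that coefficients of neighbouring orders get mixed.\<close>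

lemma weighted_sine_coefficient_poly:
  fixes f :: "real \<Rightarrow> real \<Rightarrow> complex" and \<alpha> :: "nat \<Rightarrow> complex"
  assumes cont: "\<And>r. r > 0 \<Longrightarrow> continuous_on {0..pi} (f r)"
    and coeff: "\<And>r k. r > 0 \<Longrightarrow> k \<ge> 1 \<Longrightarrow>
      ((\<lambda>t. f r t * sin (real k * t)) has_integral \<alpha> k * of_real r ^ k) {0..pi}"
    and k: "k \<ge> 2 * M + 1"
  shows "\<exists>p. degree p \<le> k + 2 * M \<and> coeff p (k + 2 * M) = (-1) ^ M * \<alpha> (k + 2 * M) \<and>
    (\<forall>r>0. ((\<lambda>t. f r t * of_real ((2 * sin t) ^ (2 * M) * sin (real k * t))) has_integral
       poly p (of_real r)) {0..pi})"
  using k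
proof (induction M arbitrary: k)
  case 0
  then show ?case
    by (intro exI[of _ "monom (\<alpha> k) k"]) (use coeff in \<open>auto simp: poly_monom degree_monom_le\<close>)
next
  case (Suc M)
  \<comment> \<open>Each factor lowers the smallest frequency by 2; the hypothesis for
    \<open>Suc M\<close> is exactly what keeps \<open>k - 2\<close> in the range of the induction
    hypothesis.\<close>
  have k: "k \<ge> 2 * M + 1" "k + 2 \<ge> 2 * M + 1" "k - 2 \<ge> 2 * M + 1"
    using Suc.prems by auto
  obtain p0 where p0: "degree p0 \<le> k + 2 * M"
    "\<And>r. r > 0 \<Longrightarrow> ((\<lambda>t. f r t * of_real ((2 * sin t) ^ (2 * M) * sin (real k * t))) has_integral poly p0 (of_real r)) {0..pi}"
    using Suc.IH[OF k(1)] by blast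
  obtain p1 where p1: "degree p1 \<le> k + 2 + 2 * M"
    "coeff p1 (k + 2 + 2 * M) = (-1) ^ M * \<alpha> (k + 2 + 2 * M)"
    "\<And>r. r > 0 \<Longrightarrow> ((\<lambda>t. f r t * of_real ((2 * sin t) ^ (2 * M) * sin (real (k + 2) * t))) has_integral poly p1 (of_real r)) {0..pi}"
    using Suc.IH[OF k(2)] by blast
  obtain p2 where p2: "degree p2 \<le> k - 2 + 2 * M"
    "\<And>r. r > 0 \<Longrightarrow> ((\<lambda>t. f r t * of_real ((2 * sin t) ^ (2 * M) * sin (real (k - 2) * t))) has_integral poly p2 (of_real r)) {0..pi}"
    using Suc.IH[OF k(3)] by blast
  define p where "p = smult 2 p0 - p1 - p2"
  \<comment> \<open>Only \<open>p1\<close> can reach the new top degree, and it enters with a minus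
    sign; this produces the factor \<open>(-1) ^ M\<close>.\<close>
  have lower: "degree (smult 2 p0) < k + 2 * Suc M" "degree p2 < k + 2 * Suc M"
    using p0(1) p2(1) Suc.prems by auto
  show ?case
  proof (intro exI conjI allI impI)
    show "degree p \<le> k + 2 * Suc M"
      unfolding p_def using lower p1(1) by (intro degree_diff_le) auto
    show "coeff p (k + 2 * Suc M) = (-1) ^ Suc M * \<alpha> (k + 2 * Suc M)"
      using p1(2) coeff_eq_0[OF lower(1)] coeff_eq_0[OF lower(2)] by (simp add: p_def)
    fix r :: real assume r: "r > 0"
    show "((\<lambda>t. f r t * of_real ((2 * sin t) ^ (2 * Suc M) * sin (real k * t))) has_integral
       poly p (of_real r)) {0..pi}"
    proof (rule has_integral_eq_rhs[OF has_integral_eq[rotated, OF has_integral_diff[OF has_integral_diff[OF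
          has_integral_mult_right[OF p0(2)[OF r], where c = 2] p1(3)[OF r]] p2(2)[OF r]]]])
      fix t :: real
      have "(2 * sin t) ^ (2 * Suc M) * sin (real k * t)
          = (2 * sin t) ^ (2 * M) * (4 * (sin t)\<^sup>2 * sin (real k * t))"
        by (simp add: power2_eq_square)
      also have "\<dots> = (2 * sin t) ^ (2 * M) * (2 * sin (real k * t) - sin (real (k + 2) * t) - sin (real (k - 2) * t))"
        using Suc.prems by (subst sin_square_sin_mult) auto
      finally have *: "(2 * sin t) ^ (2 * Suc M) * sin (real k * t) = \<dots>" .
      show "2 * (f r t * of_real ((2 * sin t) ^ (2 * M) * sin (real k * t)))
          - f r t * of_real ((2 * sin t) ^ (2 * M) * sin (real (k + 2) * t))
          - f r t * of_real ((2 * sin t) ^ (2 * M) * sin (real (k - 2) * t))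
          = f r t * of_real ((2 * sin t) ^ (2 * Suc M) * sin (real k * t))"
        unfolding * by (simp add: algebra_simps)
    qed (simp add: p_def)
  qed
qed

text \<open>A nonzero coefficient at \<open>n\<close> forces \<open>d = degree p \<ge> n\<close>.
  The quotient by \<open>r ^ d\<close> tends to the leading coefficient, yet for
  \<open>r > 1\<close> it is dominated by the quotient by \<open>r ^ n\<close>. Thus a single
  coefficient can be tested without knowing the degree in advance.\<close>

lemma poly_coeff_eq_0_if_small:
  fixes p :: "complex poly"
  assumes small: "((\<lambda>r::real. poly p (of_real r) / of_real r ^ n) \<longlongrightarrow> 0) at_top"
  shows "coeff p n = 0"
proof (rule ccontr)
  assume "coeff p n \<noteq> 0"
  then have deg: "degree p \<ge> n" by (rule le_degree)
  have "p \<noteq> 0" using \<open>coeff p n \<noteq> 0\<close> by auto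
  define d where "d = degree p"
  have lim: "((\<lambda>r. poly p (of_real r) / of_real r ^ d) \<longlongrightarrow> lead_coeff p) at_top"
  proof -
    have "((\<lambda>r::real. \<Sum>i\<le>d. coeff p i * (of_real r ^ i / of_real r ^ d)) \<longlongrightarrow>
        (\<Sum>i\<le>d. coeff p i * (if i = d then 1 else 0))) at_top"
    proof (intro tendsto_sum tendsto_mult tendsto_const)
      fix i assume "i \<in> {..d}"
      show "((\<lambda>r::real. complex_of_real r ^ i / of_real r ^ d) \<longlongrightarrow> (if i = d then 1 else 0)) at_top"
      proof (cases "i = d")
        case True
        have "eventually (\<lambda>r::real. complex_of_real r ^ i / of_real r ^ d = 1) at_top"
          using eventually_gt_at_top[of 0] by eventually_elim (use True in auto)
        then show ?thesis using True by (simp add: tendsto_eventually)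
      next
        case False
        with \<open>i \<in> {..d}\<close> have "i < d" by simp
        have "((\<lambda>r::real. inverse (r ^ (d - i))) \<longlongrightarrow> 0) at_top"
          using \<open>i < d\<close> by (intro tendsto_inverse_0_at_top filterlim_pow_at_top filterlim_ident) auto
        then have "((\<lambda>r::real. complex_of_real (inverse (r ^ (d - i)))) \<longlongrightarrow> of_real 0) at_top"
          by (rule tendsto_of_real)
        moreover have "eventually (\<lambda>r::real. complex_of_real (inverse (r ^ (d - i))) = of_real r ^ i / of_real r ^ d) at_top"
          using eventually_gt_at_top[of 0]
        proof eventually_elim
          case (elim r)
          then show ?case using \<open>i < d\<close> by (simp add: power_diff field_simps)
        qed
        ultimately show ?thesis using False by (auto intro: Lim_transform_eventually)
      qed
    qed
    moreover have "(\<Sum>i\<le>d. coeff p i * (if i = d then 1 else 0)) = lead_coeff p"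
      by (simp add: d_def if_distrib[of "\<lambda>x. _ * x"] sum.delta cong: if_cong)
    moreover have "(\<Sum>i\<le>d. coeff p i * (of_real r ^ i / of_real r ^ d)) = poly p (of_real r) / of_real r ^ d" for r
      by (simp add: poly_altdef d_def sum_divide_distrib)
    ultimately show ?thesis by simp
  qed
  have bound: "((\<lambda>r. poly p (of_real r) / of_real r ^ d) \<longlongrightarrow> 0) at_top"
  proof (rule Lim_null_comparison)
    show "eventually (\<lambda>r. cmod (poly p (of_real r) / of_real r ^ d) \<le> cmod (poly p (of_real r) / of_real r ^ n)) at_top"
      using eventually_gt_at_top[of 1]
    proof eventually_elim
      case (elim r)
      then show ?case
        unfolding norm_divide norm_power norm_of_real
        using deg by (intro divide_left_mono power_increasing) (auto simp: d_def)
    qed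
    show "((\<lambda>r::real. cmod (poly p (of_real r) / of_real r ^ n)) \<longlongrightarrow> 0) at_top"
      using small by (rule tendsto_norm_zero)
  qed
  have "lead_coeff p = 0" using tendsto_unique[OF _ lim bound] by simp
  then show False using \<open>p \<noteq> 0\<close> by simp
qed

lemma poly_coeff_eq_0_if_powr_bound:
  fixes p :: "complex poly"
  assumes "\<And>r::real. r > R \<Longrightarrow> cmod (poly p (of_real r)) \<le> C * r powr N"
    and "real n > N"
  shows "coeff p n = 0"
proof (rule poly_coeff_eq_0_if_small, rule Lim_null_comparison)
  show "eventually (\<lambda>r. cmod (poly p (of_real r) / of_real r ^ n) \<le> C * r powr (N - n)) at_top"
    using eventually_gt_at_top[of "max R 1"]
  proof eventually_elim
    case (elim r)
    then have "cmod (poly p (of_real r) / of_real r ^ n) = cmod (poly p (of_real r)) / r ^ n"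
      by (simp add: norm_divide norm_power)
    also have "\<dots> \<le> C * r powr N / r ^ n"
      using elim assms(1)[of r] by (intro divide_right_mono) auto
    finally show ?case using elim by (simp add: powr_diff powr_realpow)
  qed
  have "((\<lambda>r::real. r powr (N - n)) \<longlongrightarrow> 0) at_top"
    using assms(2) by (intro tendsto_neg_powr filterlim_ident) simp
  then show "((\<lambda>r::real. C * r powr (N - n)) \<longlongrightarrow> 0) at_top"
    by (rule tendsto_mult_right_zero)
qed

text \<open>The weight \<open>(2 * sin t) ^ (2 * M)\<close> with \<open>M \<ge> N\<close> absorbs
  the singularity at the endpoints, so the weighted integral grows at most like
  \<open>r powr N\<close>. It is a polynomial in \<open>r\<close> whose coefficient at
  \<open>n\<close> is \<open>\<alpha> n\<close> up to sign, and that coefficient vanishes for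
  \<open>n > N\<close>.\<close>

lemma sine_coefficients_eventually_0:
  fixes f :: "real \<Rightarrow> real \<Rightarrow> complex" and \<alpha> :: "nat \<Rightarrow> complex"
  assumes cont: "\<And>r. r > 0 \<Longrightarrow> continuous_on {0..pi} (f r)"
    and coeff: "\<And>r k. r > 0 \<Longrightarrow> k \<ge> 1 \<Longrightarrow>
      ((\<lambda>t. f r t * sin (real k * t)) has_integral \<alpha> k * of_real r ^ k) {0..pi}"
    and growth: "\<And>r t. r > R \<Longrightarrow> 0 < t \<Longrightarrow> t < pi \<Longrightarrow> cmod (f r t) \<le> C * (r / sin t) powr N"
    and "C > 0" "N > 0" "R > 0"
  shows "\<exists>K. \<forall>k\<ge>K. \<alpha> k = 0"
proof -
  obtain M :: nat where M: "real M \<ge> N" using real_arch_simple by blast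
  \<comment> \<open>The threshold is what \<open>k = n - 2 * M\<close> needs in order to satisfy
    \<open>k \<ge> 2 * M + 1\<close>.\<close>
  have "\<alpha> n = 0" if n: "n \<ge> 4 * M + 1" for n
  proof -
    define k where "k = n - 2 * M"
    have k: "k \<ge> 2 * M + 1" "k + 2 * M = n" using n by (auto simp: k_def)
    obtain p where p: "coeff p n = (-1) ^ M * \<alpha> n"
      "\<And>r. r > 0 \<Longrightarrow> ((\<lambda>t. f r t * of_real ((2 * sin t) ^ (2 * M) * sin (real k * t))) has_integral
       poly p (of_real r)) {0..pi}"
      using weighted_sine_coefficient_poly[OF cont coeff k(1)] unfolding k(2) by blast
    have "coeff p n = 0"
    proof (rule poly_coeff_eq_0_if_powr_bound)
      fix r assume r: "r > R"
      have "cmod (poly p (of_real r)) \<le> C * r powr N * 4 ^ M * measure lborel {0..pi}"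
      proof (rule has_integral_bound_real[OF _ _ p(2)])
        \<comment> \<open>The growth bound holds only for \<open>0 < t < pi\<close>; the endpoints
          are a finite exceptional set for the integral estimate.\<close>
        fix t assume t: "t \<in> {0..pi} - {0, pi}"
        have s: "sin t > 0" "sin t \<le> 1" using t by (auto intro: sin_gt_zero)
        have "cmod (f r t * of_real ((2 * sin t) ^ (2 * M) * sin (real k * t)))
          \<le> C * (r / sin t) powr N * (4 ^ M * (sin t) powr N)"
          unfolding norm_mult norm_of_real
        proof (rule mult_mono)
          have "\<bar>(2 * sin t) ^ (2 * M) * sin (real k * t)\<bar> \<le> \<bar>(2 * sin t) ^ (2 * M)\<bar> * 1"
            unfolding abs_mult by (intro mult_left_mono) auto
          also have "\<dots> = 4 ^ M * (sin t powr real (2 * M))"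
            using s powr_realpow[of "sin t" "2 * M"] by (simp add: power_mult_distrib power_mult)
          also have "\<dots> \<le> 4 ^ M * (sin t powr N)"
            using s M \<open>N > 0\<close> by (intro mult_left_mono powr_mono') auto
          finally show "\<bar>(2 * sin t) ^ (2 * M) * sin (real k * t)\<bar> \<le> \<dots>" .
          show "cmod (f r t) \<le> C * (r / sin t) powr N" using growth[OF r] t by auto
        qed (use \<open>C > 0\<close> in auto)
        also have "\<dots> = C * r powr N * 4 ^ M"
          using s r \<open>R > 0\<close> by (simp add: powr_divide)
        finally show "cmod (f r t * of_real ((2 * sin t) ^ (2 * M) * sin (real k * t))) \<le> C * r powr N * 4 ^ M" .
      qed (use \<open>C > 0\<close> r \<open>R > 0\<close> in auto)
      then show "cmod (poly p (of_real r)) \<le> (C * 4 ^ M * pi) * r powr N"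
        by (simp add: mult_ac)
    next
      show "N < real n" using M n \<open>N > 0\<close> by linarith
    qed
    then show ?thesis using p(1) by simp
  qed
  then show ?thesis by blast
qed

section \<open>Completeness and orthogonality of the sines on \<open>{0..pi}\<close>\<close>

text \<open>For a polynomial \<open>q\<close>, the function \<open>q (cos t) * sin t\<close> is a
  combination of sines, hence orthogonal to \<open>f\<close>. Weierstrass approximation in the
  variable \<open>x = cos t\<close> then makes the integral of \<open>(f t)\<^sup>2 * sin t\<close>
  vanish, and the weight \<open>sin t\<close> is positive inside the interval.\<close>

lemma sine_system_complete_real:
  fixes f :: "real \<Rightarrow> real"
  assumes cont: "continuous_on {0..pi} f"
    and orth: "\<And>k. k \<ge> 1 \<Longrightarrow> ((\<lambda>t. f t * sin (real k * t)) has_integral 0) {0..pi}"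
    and t: "0 < t" "t < pi"
  shows "f t = 0"
proof -
  have cos_sin: "((\<lambda>t. f t * (cos t ^ j * sin (real k * t))) has_integral 0) {0..pi}" if "k \<ge> 1" for j k
    using that
  proof (induction j arbitrary: k)
    case 0
    then show ?case using orth by simp
  next
    case (Suc j)
    have 1: "((\<lambda>t. f t * (cos t ^ j * sin (real (k + 1) * t))) has_integral 0) {0..pi}"
      using Suc.IH[of "k + 1"] by simp
    \<comment> \<open>For \<open>k = 1\<close> the lower frequency is 0 and the integrand vanishes
      identically; the induction hypothesis covers the other case.\<close>
    have 2: "((\<lambda>t. f t * (cos t ^ j * sin (real (k - 1) * t))) has_integral 0) {0..pi}"
      using Suc.IH[of "k - 1"] Suc.prems by (cases "k = 1") (simp_all del: of_nat_diff)
    have *: "cos t * sin (real k * t) = (sin (real (k + 1) * t) + sin (real (k - 1) * t)) / 2" for t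
    proof -
      have 1: "real (k + 1) * t = real k * t + t" and 2: "real (k - 1) * t = real k * t - t"
        using Suc.prems by (simp_all add: algebra_simps)
      show ?thesis unfolding 1 2 sin_add sin_diff by simp
    qed
    have eq: "f t * (cos t ^ Suc j * sin (real k * t)) =
      (f t * (cos t ^ j * sin (real (k + 1) * t)) + f t * (cos t ^ j * sin (real (k - 1) * t))) * (1/2)" for t
    proof -
      have "f t * (cos t ^ Suc j * sin (real k * t)) = f t * (cos t ^ j * (cos t * sin (real k * t)))"
        by simp
      then show ?thesis unfolding * by (simp add: algebra_simps)
    qed
    show ?case
      unfolding eq by (rule has_integral_eq_rhs[OF has_integral_mult_left[OF has_integral_add[OF 1 2]]]) simp
  qed
  have poly: "((\<lambda>t. f t * (q (cos t) * sin t)) has_integral 0) {0..pi}"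
    if q_poly: "real_polynomial_function q" for q
  proof -
    from real_polynomial_function_imp_sum[OF q_poly]
    obtain a n where q: "q = (\<lambda>x. \<Sum>i\<le>n. a i * x ^ i)"
      by (elim exE) (rule that)
    have "((\<lambda>t. \<Sum>i\<le>n. a i * (f t * (cos t ^ i * sin (real 1 * t)))) has_integral (\<Sum>i\<le>n. a i * 0)) {0..pi}"
      by (intro has_integral_sum has_integral_mult_right cos_sin) auto
    then show ?thesis by (simp add: q sum_distrib_left sum_distrib_right mult_ac)
  qed
  define F where "F = (\<lambda>x. f (arccos x))"
  have contF: "continuous_on {-1..1} F"
    unfolding F_def by (rule continuous_on_compose2[OF cont]) (auto intro!: continuous_intros arccos_lbound arccos_ubound)
  have F_cos: "F (cos t) = f t" if "t \<in> {0..pi}" for t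
    using that by (simp add: F_def arccos_cos)
  have contsq: "continuous_on {0..pi} (\<lambda>t. (f t)\<^sup>2 * sin t)"
    by (intro continuous_intros cont)
  define I where "I = integral {0..pi} (\<lambda>t. (f t)\<^sup>2 * sin t)"
  have I: "((\<lambda>t. (f t)\<^sup>2 * sin t) has_integral I) {0..pi}"
    unfolding I_def by (intro integrable_integral integrable_continuous_real contsq)
  obtain B where B: "B > 0" "\<And>t. t \<in> {0..pi} \<Longrightarrow> \<bar>f t\<bar> \<le> B"
    using compact_imp_bounded[OF compact_continuous_image[OF cont compact_Icc]]
    unfolding bounded_pos by (auto simp: image_iff)
  have "norm I \<le> 0"
  proof (rule field_le_epsilon)
    fix e :: real assume "e > 0"
    \<comment> \<open>Chosen so that the final bound \<open>B * d * pi\<close> equals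
      \<open>e\<close>.\<close>
    define d where "d = e / (B * pi)"
    have "d > 0" using \<open>e > 0\<close> B by (simp add: d_def)
    obtain q where q: "real_polynomial_function q" "\<And>x. x \<in> {-1..1} \<Longrightarrow> \<bar>F x - q x\<bar> < d"
      using Stone_Weierstrass_real_polynomial_function[OF compact_Icc contF \<open>d > 0\<close>] by blast
    have "norm (I - 0) \<le> (B * d) * measure lborel {0..pi}"
    proof (rule has_integral_bound_real[OF _ finite.emptyI has_integral_diff[OF I poly[OF q(1)]]])
      fix t assume "t \<in> {0..pi} - {}"
      then have t: "t \<in> {0..pi}" by simp
      have "\<bar>f t\<bar> * \<bar>f t - q (cos t)\<bar> * \<bar>sin t\<bar> \<le> B * d * 1"
        using t B q(2)[of "cos t"] F_cos[OF t] \<open>d > 0\<close> by (intro mult_mono) auto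
      moreover have "(f t)\<^sup>2 * sin t - f t * (q (cos t) * sin t) = f t * (f t - q (cos t)) * sin t"
        by (simp add: algebra_simps power2_eq_square)
      ultimately show "norm ((f t)\<^sup>2 * sin t - f t * (q (cos t) * sin t)) \<le> B * d"
        by (simp add: abs_mult)
    qed (use B \<open>d > 0\<close> in auto)
    also have "\<dots> = e" using B by (simp add: d_def)
    finally show "norm I \<le> 0 + e" by simp
  qed
  then have "((\<lambda>t. (f t)\<^sup>2 * sin t) has_integral 0) (cbox 0 pi)" using I by simp
  then have "(f t)\<^sup>2 * sin t = 0"
    by (rule has_integral_0_cbox_imp_0[rotated 2])
      (use contsq t in \<open>auto intro!: mult_nonneg_nonneg sin_ge_zero\<close>)
  then show ?thesis using t sin_gt_zero[of t] by simp
qed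

lemma sine_system_complete:
  fixes f :: "real \<Rightarrow> complex"
  assumes cont: "continuous_on {0..pi} f"
    and orth: "\<And>k. k \<ge> 1 \<Longrightarrow> ((\<lambda>t. f t * sin (real k * t)) has_integral 0) {0..pi}"
    and t: "0 < t" "t < pi"
  shows "f t = 0"
proof -
  have "Re (f t) = 0"
    by (rule sine_system_complete_real[OF _ _ t])
      (use has_integral_Re[OF orth] in \<open>auto intro!: continuous_intros cont\<close>)
  moreover have "Im (f t) = 0"
    by (rule sine_system_complete_real[OF _ _ t])
      (use has_integral_Im[OF orth] in \<open>auto intro!: continuous_intros cont\<close>)
  ultimately show ?thesis by (simp add: complex_eq_iff)
qed

text \<open>Frequencies are integers because the product formula for sines produces
  \<open>j - k\<close>, which may be negative.\<close>

lemma has_integral_cos_of_int_mult: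
  "((\<lambda>t. cos (real_of_int n * t)) has_integral (if n = 0 then pi else 0)) {0..pi}"
proof (cases "n = 0")
  case True
  then show ?thesis using has_integral_const_real[of "1::real" 0 pi] by simp
next
  case False
  have "((\<lambda>t. cos (real_of_int n * t)) has_integral
      (sin (real_of_int n * pi) / real_of_int n - sin (real_of_int n * 0) / real_of_int n)) {0..pi}"
    by (rule fundamental_theorem_of_calculus)
      (use False in \<open>auto intro!: derivative_eq_intros simp flip: has_real_derivative_iff_has_vector_derivative\<close>)
  moreover have "sin (real_of_int n * pi) = 0"
    by (subst mult.commute) (rule sin_npi_int)
  ultimately show ?thesis using False by simp
qed

lemma has_integral_sin_sin:
  assumes "j \<ge> 1" "k \<ge> 1"
  shows "((\<lambda>t. sin (real j * t) * sin (real k * t)) has_integral (if j = k then pi / 2 else 0)) {0..pi}"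
proof -
  have *: "sin (real j * t) * sin (real k * t)
      = (cos (real_of_int (int j - int k) * t) - cos (real_of_int (int j + int k) * t)) * (1 / 2)" for t
    by (simp add: sin_times_sin left_diff_distrib distrib_right)
  show ?thesis
    unfolding *
    by (rule has_integral_eq_rhs[OF has_integral_mult_left[OF has_integral_diff[OF
        has_integral_cos_of_int_mult has_integral_cos_of_int_mult]]])
      (use assms in auto)
qed

section \<open>Zero extension, finite expansion and the conclusion along rays\<close>

text \<open>Continuity on the whole plane yields uniform continuity on closed discs crossing the
  real axis, as the shift argument requires.\<close>

lemma continuous_zero_extension:
  assumes "continuous_on upper_half_plane u"
    and "\<And>x::real. (u \<longlongrightarrow> 0) (at (of_real x) within upper_half_plane)"
  shows "continuous_on UNIV (\<lambda>z. if z \<in> upper_half_plane then u z else 0)" (is "continuous_on UNIV ?U")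
proof -
  have op: "open upper_half_plane"
    unfolding upper_half_plane_def by (rule open_halfspace_Im_gt)
  have "isCont ?U z" for z
  proof (cases "Im z" "0::real" rule: linorder_cases)
    case less
    have "eventually (\<lambda>w. w \<in> {w. Im w < 0}) (nhds z)"
      using less by (intro eventually_nhds_in_open open_halfspace_Im_lt) auto
    then have "eventually (\<lambda>w. ?U w = 0) (nhds z)"
      by eventually_elim (auto simp: upper_half_plane_def)
    then show ?thesis
      by (subst isCont_cong) (auto simp: continuous_const)
  next
    \<comment> \<open>At a real point the limit is taken separately through the half-plane, where
      the hypothesis applies, and through its complement, where the extension is constantly
      0.\<close>
    case equal
    then have z: "z = of_real (Re z)" "z \<notin> upper_half_plane"
      by (auto simp: complex_eq_iff upper_half_plane_def)
    have "(?U \<longlongrightarrow> 0) (at z within upper_half_plane)"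
      using assms(2)[of "Re z"] unfolding z(1)[symmetric]
      by (rule Lim_transform_eventually) (simp add: eventually_at_filter)
    moreover have "(?U \<longlongrightarrow> 0) (at z within - upper_half_plane)"
      by (rule tendsto_eventually) (simp add: eventually_at_filter)
    ultimately have "(?U \<longlongrightarrow> 0) (at z within (upper_half_plane \<union> - upper_half_plane))"
      by (rule Lim_Un)
    then show ?thesis using z(2) by (simp add: isCont_def)
  next
    case greater
    then have z: "z \<in> upper_half_plane" by (simp add: upper_half_plane_def)
    have "eventually (\<lambda>w. w \<in> upper_half_plane) (nhds z)"
      using op z by (rule eventually_nhds_in_open)
    then have "eventually (\<lambda>w. ?U w = u w) (nhds z)"
      by eventually_elim simp
    moreover have "isCont u z"
      using assms(1) op z by (simp add: continuous_on_eq_continuous_at)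
    ultimately show ?thesis
      by (simp add: isCont_cong[of ?U u z])
  qed
  then show ?thesis by (simp add: continuous_on_eq_continuous_at)
qed

text \<open>On each half circle, the zero extension minus the finite sum has all sine coefficients
  0, so completeness applies. Homogeneity of the coefficients in \<open>r\<close> is what makes
  \<open>c\<close> independent of the radius.\<close>

lemma finite_sine_expansion:
  fixes u :: "complex \<Rightarrow> complex"
  assumes harm: "harmonic_on upper_half_plane u"
    and temp: "temperate_growth_at_infinity u"
    and bdry: "\<And>x::real. (u \<longlongrightarrow> 0) (at (of_real x) within upper_half_plane)"
  shows "\<exists>K c. \<forall>r t. r > 0 \<longrightarrow> 0 < t \<longrightarrow> t < pi \<longrightarrow>
       u (rcis r t) = (\<Sum>k=1..K. c k * of_real r ^ k * of_real (sin (real k * t)))"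
proof -
  define U where "U = (\<lambda>z. if z \<in> upper_half_plane then u z else 0)"
  have "Ck_on (Suc (Suc 0)) upper_half_plane u"
    using harm by (simp add: harmonic_on_def numeral_2_eq_2)
  then have "continuous_on upper_half_plane u" by simp
  then have contU: "continuous_on UNIV U"
    unfolding U_def using bdry by (rule continuous_zero_extension)
  have U0: "U (of_real x) = 0" for x :: real
    by (simp add: U_def upper_half_plane_def)
  have Uu: "U (rcis r t) = u (rcis r t)" if "r > 0" "0 < t" "t < pi" for r t
    using that sin_gt_zero by (auto simp: U_def upper_half_plane_def)
  have dec: "\<exists>g h. g holomorphic_on {z. Re z > p \<and> Im z > q} \<and>
       h holomorphic_on {z. Re z > p \<and> Im z > q} \<and>
       (\<forall>z. Re z > p \<longrightarrow> Im z > q \<longrightarrow> U z = g z + cnj (h z))" if "q > 0" for p q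
  proof -
    have sub: "{z. Re z \<ge> p \<and> Im z \<ge> q} \<subseteq> upper_half_plane"
      using that by (auto simp: upper_half_plane_def)
    obtain g h where "g holomorphic_on {z. Re z > p \<and> Im z > q}"
      "h holomorphic_on {z. Re z > p \<and> Im z > q}"
      "\<And>z. Re z > p \<Longrightarrow> Im z > q \<Longrightarrow> u z = g z + cnj (h z)"
      using harmonic_on_decompose[OF harm sub] by blast
    then show ?thesis
      using that by (intro exI[of _ g] exI[of _ h]) (auto simp: U_def upper_half_plane_def)
  qed
  define f where "f = (\<lambda>r t. U (rcis r t))"
  have contf: "continuous_on A (f r)" for A r
    unfolding f_def by (intro continuous_intros continuous_on_compose2[OF contU]) (auto simp: rcis_def)
  \<comment> \<open>Radius 1 serves as reference. Homogeneity compares two ordered radii, hence the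
    case split on \<open>r \<le> 1\<close> below.\<close>
  define \<alpha> where "\<alpha> = (\<lambda>k. integral {0..pi} (\<lambda>t. f 1 t * sin (real k * t)))"
  have coeff: "((\<lambda>t. f r t * sin (real k * t)) has_integral \<alpha> k * of_real r ^ k) {0..pi}"
    if "r > 0" "k \<ge> 1" for r k
  proof -
    have "integral {0..pi} (\<lambda>t. f r t * sin (real k * t)) / of_real r ^ k = \<alpha> k"
    proof (cases "r \<le> 1")
      case True
      show ?thesis
        using sine_coefficient_homogeneous[OF \<open>k \<ge> 1\<close> contU U0 dec \<open>r > 0\<close> True] by (simp add: f_def \<alpha>_def)
    next
      case False
      then have "1 \<le> r" by simp
      show ?thesis
        using sine_coefficient_homogeneous[OF \<open>k \<ge> 1\<close> contU U0 dec zero_less_one \<open>1 \<le> r\<close>]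
        by (simp add: f_def \<alpha>_def)
    qed
    then have "integral {0..pi} (\<lambda>t. f r t * sin (real k * t)) = \<alpha> k * of_real r ^ k"
      using \<open>r > 0\<close> by (simp add: field_simps)
    moreover have "(\<lambda>t. f r t * sin (real k * t)) integrable_on {0..pi}"
      by (intro integrable_continuous_real continuous_intros contf)
    ultimately show ?thesis by (metis integrable_integral)
  qed
  obtain C R N where CRN: "C > 0" "R > 0" "N > 0"
    "\<And>z. z \<in> upper_half_plane \<Longrightarrow> cmod z > R \<Longrightarrow> cmod (u z) \<le> C * ((cmod z)\<^sup>2 / Im z) powr N"
    using temp unfolding temperate_growth_at_infinity_def by blast
  have growth: "cmod (f r t) \<le> C * (r / sin t) powr N" if "r > R" "0 < t" "t < pi" for r t
  proof -
    have "r > 0" using that CRN by simp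
    moreover have "sin t > 0" using that by (intro sin_gt_zero)
    ultimately show ?thesis
      using CRN(4)[of "rcis r t"] Uu[of r t] that
      by (simp add: f_def upper_half_plane_def power2_eq_square)
  qed
  obtain K where K: "\<And>k. k \<ge> K \<Longrightarrow> \<alpha> k = 0"
    using sine_coefficients_eventually_0[OF contf coeff growth CRN(1,3,2)] by blast
  \<comment> \<open>The factor \<open>2 / pi\<close> inverts the integral \<open>pi / 2\<close> of
    the squared sine.\<close>
  define c where "c = (\<lambda>k. 2 / pi * \<alpha> k)"
  show ?thesis
  proof (intro exI[of _ K] exI[of _ c] allI impI)
    fix r t :: real assume rt: "r > 0" "0 < t" "t < pi"
    define S where "S = (\<lambda>t. \<Sum>k=1..K. c k * of_real r ^ k * of_real (sin (real k * t)))"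
    have "f r t - S t = 0"
    proof (rule sine_system_complete[OF _ _ rt(2,3)])
      show "continuous_on {0..pi} (\<lambda>t. f r t - S t)"
        unfolding S_def by (intro continuous_intros contf)
      fix j :: nat assume j: "j \<ge> 1"
      have sc: "((\<lambda>t. of_real (sin (real k * t) * sin (real j * t))) has_integral
          complex_of_real (if k = j then pi / 2 else 0)) {0..pi}" if "k \<in> {1..K}" for k
        using that j by (intro has_integral_of_real has_integral_sin_sin) auto
      have "((\<lambda>t. \<Sum>k=1..K. c k * of_real r ^ k * of_real (sin (real k * t) * sin (real j * t)))
          has_integral (\<Sum>k=1..K. c k * of_real r ^ k * complex_of_real (if k = j then pi / 2 else 0))) {0..pi}"
        by (intro has_integral_sum has_integral_mult_right sc) auto
      moreover have "(\<Sum>k=1..K. c k * of_real r ^ k * complex_of_real (if k = j then pi / 2 else 0))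
          = (\<Sum>k=1..K. if k = j then \<alpha> j * of_real r ^ j else 0)"
        by (intro sum.cong) (auto simp: c_def)
      \<comment> \<open>For \<open>j > K\<close> no summand survives, and the right-hand side is 0
        by the choice of \<open>K\<close>.\<close>
      moreover have "\<dots> = \<alpha> j * of_real r ^ j"
        using j K[of j] by (auto simp: not_le)
      ultimately have "((\<lambda>t. S t * of_real (sin (real j * t))) has_integral \<alpha> j * of_real r ^ j) {0..pi}"
        by (simp add: S_def sum_distrib_right mult.assoc)
      from has_integral_diff[OF coeff[OF rt(1) j] this]
      show "((\<lambda>t. (f r t - S t) * of_real (sin (real j * t))) has_integral 0) {0..pi}"
        by (simp add: left_diff_distrib)
    qed
    then show "u (rcis r t) = (\<Sum>k=1..K. c k * of_real r ^ k * of_real (sin (real k * t)))"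
      using Uu[OF rt] by (simp add: f_def S_def)
  qed
qed

theorem theorem8p3:
  fixes u :: "complex \<Rightarrow> complex"
  assumes "harmonic_on upper_half_plane u"
    and "temperate_growth_at_infinity u"
    and "\<And>x::real. (u \<longlongrightarrow> 0) (at (of_real x) within upper_half_plane)"
    and "\<exists>E \<eta>. admissible_angles E \<eta> \<and>
           (\<forall>\<theta>\<in>E. ((\<lambda>t::real. u (of_real t * exp (\<i> * of_real \<theta>)) / of_real t ^ \<eta> \<theta>) \<longlongrightarrow> 0) at_top)"
  shows "\<forall>z\<in>upper_half_plane. u z = 0"
proof -
  obtain K c where expansion: "\<And>r t. r > 0 \<Longrightarrow> 0 < t \<Longrightarrow> t < pi \<Longrightarrow>
       u (rcis r t) = (\<Sum>k=1..K. c k * of_real r ^ k * of_real (sin (real k * t)))"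
    using finite_sine_expansion[OF assms(1-3)] by blast
  obtain E \<eta> where E: "admissible_angles E \<eta>"
    "\<And>\<theta>. \<theta> \<in> E \<Longrightarrow> ((\<lambda>t::real. u (of_real t * exp (\<i> * of_real \<theta>)) / of_real t ^ \<eta> \<theta>) \<longlongrightarrow> 0) at_top"
    using assms(4) by blast
  \<comment> \<open>Each order is treated on its own, without induction: on the ray that
    admissibility supplies for \<open>n\<close>, \<open>u\<close> is a polynomial \<open>p\<close>
    in the radius, and \<open>n \<ge> \<eta> \<theta>\<close> turns the decay hypothesis into decay
    of \<open>p\<close> divided by the power \<open>n\<close>. So its coefficient
    \<open>c n * sin (n * \<theta>)\<close> vanishes, while the sine does not.\<close>
  have c0: "c n = 0" if n: "n \<in> {1..K}" for n
  proof -
    have "E \<subseteq> {0<..<pi}" "\<exists>\<theta>\<in>E. sin (real n * \<theta>) \<noteq> 0 \<and> n \<ge> \<eta> \<theta>"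
      using E(1) n by (simp_all add: admissible_angles_def)
    then obtain \<theta> where \<theta>: "\<theta> \<in> E" "sin (real n * \<theta>) \<noteq> 0" "n \<ge> \<eta> \<theta>" "0 < \<theta>" "\<theta> < pi"
      by auto
    define p where "p = (\<Sum>k=1..K. monom (c k * of_real (sin (real k * \<theta>))) k)"
    have p: "u (of_real r * exp (\<i> * of_real \<theta>)) = poly p (of_real r)" if "r > 0" for r
      using expansion[OF that \<theta>(4,5)]
      by (simp add: p_def poly_sum poly_monom rcis_def cis_conv_exp mult_ac)
    have "((\<lambda>r. poly p (of_real r) / of_real r ^ n) \<longlongrightarrow> 0) at_top"
    proof (rule Lim_null_comparison)
      show "eventually (\<lambda>r::real. cmod (poly p (of_real r) / of_real r ^ n)
          \<le> cmod (u (of_real r * exp (\<i> * of_real \<theta>)) / of_real r ^ \<eta> \<theta>)) at_top"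
        using eventually_gt_at_top[of 1]
      proof eventually_elim
        case (elim r)
        then have "u (of_real r * exp (\<i> * of_real \<theta>)) = poly p (of_real r)"
          by (intro p) simp
        then show ?case
          unfolding norm_divide norm_power norm_of_real
          using elim \<theta>(3) by (auto intro!: divide_left_mono power_increasing)
      qed
      show "((\<lambda>r. cmod (u (of_real r * exp (\<i> * of_real \<theta>)) / of_real r ^ \<eta> \<theta>)) \<longlongrightarrow> 0) at_top"
        using E(2)[OF \<theta>(1)] by (rule tendsto_norm_zero)
    qed
    then have "coeff p n = 0" by (rule poly_coeff_eq_0_if_small)
    moreover have "coeff p n = c n * of_real (sin (real n * \<theta>))"
      using n by (simp add: p_def coeff_sum)
    ultimately show ?thesis using \<theta>(2) by simp
  qed
  show ?thesis
  proof
    fix z assume z: "z \<in> upper_half_plane"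
    then have "z \<noteq> 0" "0 < Im z" by (auto simp: upper_half_plane_def)
    then have "0 < Arg z" "Arg z < pi"
      using Arg_lt_pi by blast+
    then have "u (rcis (cmod z) (Arg z)) = 0"
      using expansion[of "cmod z" "Arg z"] \<open>z \<noteq> 0\<close> c0 by simp
    then show "u z = 0" by (simp add: rcis_cmod_Arg)
  qed
qed

end
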